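(* Let $p$ be a prime, $d\in\mathbb{N}$ and $\ell=\ell_p(d)=\lceil\log_p(d+1)\rceil$. If $n\ge 4p^\ell-1$, then for every $E\subseteq[d,n-d]$, over $\mathbb{F}_p$ we have $\operatorname{Z\text{-}cl}_{n,d}(E)=\operatorname{Sym\text{-}cl}_{n,d}(E)$.
   Context: For integers $a\le b$, $[a,b]$ denotes the set of integers between $a$ and $b$. Work over $\mathbb{F}_p$ with $\{0,1\}^n\subseteq\mathbb{F}_p^n$; $|x|$ is the Hamming weight of $x\in\{0,1\}^n$, and for $E\subseteq[0,n]$, $\underline{E}=\{x\in\{0,1\}^n:|x|\in E\}$. The degree-$d$ Zariski closure $\operatorname{Z\text{-}cl}_{n,d}(\underline{E})$ is the set of $y\in\{0,1\}^n$ at which every polynomial in $\mathbb{F}_p[X_1,\dots,X_n]$ of degree at most $d$ vanishing on $\underline{E}$ also vanishes. The degree-$d$ symmetric closure $\operatorname{Sym\text{-}cl}_{n,d}(\underline{E})$ is the set of $y\in\{0,1\}^n$ at which every symmetric polynomial in $\mathbb{F}_p[X_1,\dots,X_n]$ (invariant under all permutations of the variables) of degree at most $d$ vanishing on $\underline{E}$ also vanishes. Both sets are symmetric, and are identified with the corresponding sets of Hamming weights in $[0,n]$, denoted $\operatorname{Z\text{-}cl}_{n,d}(E)$ and $\operatorname{Sym\text{-}cl}_{n,d}(E)$. *)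

theory Defs
  imports
    Complex_Main
    "HOL-Library.Poly_Mapping"
    "HOL-Library.FuncSet"
    "HOL-Combinatorics.Permutations"
    "Berlekamp_Zassenhaus.Finite_Field"
begin

text \<open>
  Polynomials with coefficients in \<open>'a\<close> are finitely supported maps from exponent vectors to
  coefficients. The ring \<open>K[X\<^sub>1,\<dots>,X\<^sub>n]\<close> is carved out by \<open>poly_vars_in\<close>, with the variables
  indexed by \<open>{..<n}\<close>.
\<close>

type_synonym 'a mvpoly = "(nat \<Rightarrow>\<^sub>0 nat) \<Rightarrow>\<^sub>0 'a"

definition poly_vars_in :: "nat \<Rightarrow> 'a::zero mvpoly \<Rightarrow> bool" where
  "poly_vars_in n P \<longleftrightarrow> (\<forall>m\<in>Poly_Mapping.keys P. Poly_Mapping.keys m \<subseteq> {..<n})"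

definition monom_degree :: "(nat \<Rightarrow>\<^sub>0 nat) \<Rightarrow> nat" where
  "monom_degree m = (\<Sum>i\<in>Poly_Mapping.keys m. Poly_Mapping.lookup m i)"

text \<open>The zero polynomial gets degree \<open>0\<close>, so it counts as having degree at most \<open>d\<close> for every \<open>d\<close>.\<close>

definition total_degree :: "'a::zero mvpoly \<Rightarrow> nat" where
  "total_degree P = Max (insert 0 (monom_degree ` Poly_Mapping.keys P))"

definition mv_eval :: "'a::comm_semiring_1 mvpoly \<Rightarrow> (nat \<Rightarrow> 'a) \<Rightarrow> 'a" where
  "mv_eval P x =
     (\<Sum>m\<in>Poly_Mapping.keys P.
        Poly_Mapping.lookup P m * (\<Prod>i\<in>Poly_Mapping.keys m. x i ^ Poly_Mapping.lookup m i))"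

text \<open>
  For bijective \<open>\<pi>\<close>, the coefficient of \<open>m\<close> in \<open>permute_vars \<pi> P\<close> is the coefficient of
  \<open>m \<circ> \<pi>\<close> in \<open>P\<close>: the variable with index \<open>i\<close> is replaced by the one with index \<open>\<pi> i\<close>.
\<close>

definition permute_vars :: "(nat \<Rightarrow> nat) \<Rightarrow> 'a::zero mvpoly \<Rightarrow> 'a mvpoly" where
  "permute_vars \<pi> P = Poly_Mapping.map_key (Poly_Mapping.map_key \<pi>) P"

definition symmetric_poly :: "nat \<Rightarrow> 'a::zero mvpoly \<Rightarrow> bool" where
  "symmetric_poly n P \<longleftrightarrow> (\<forall>\<pi>. \<pi> permutes {..<n} \<longrightarrow> permute_vars \<pi> P = P)"

definition cube :: "nat \<Rightarrow> (nat \<Rightarrow> 'a::zero_neq_one) set" where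
  "cube n = {..<n} \<rightarrow>\<^sub>E {0, 1}"

definition hamming_weight :: "nat \<Rightarrow> (nat \<Rightarrow> 'a::zero_neq_one) \<Rightarrow> nat" where
  "hamming_weight n x = card {i \<in> {..<n}. x i = 1}"

definition layers :: "nat \<Rightarrow> nat set \<Rightarrow> (nat \<Rightarrow> 'a::zero_neq_one) set" where
  "layers n E = {x \<in> cube n. hamming_weight n x \<in> E}"

definition Z_closure :: "nat \<Rightarrow> nat \<Rightarrow> (nat \<Rightarrow> 'a::field) set \<Rightarrow> (nat \<Rightarrow> 'a) set" where
  "Z_closure n d S =
     {y \<in> cube n. \<forall>P. poly_vars_in n P \<and> total_degree P \<le> d \<and> (\<forall>x\<in>S. mv_eval P x = 0)
        \<longrightarrow> mv_eval P y = 0}"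

definition Sym_closure :: "nat \<Rightarrow> nat \<Rightarrow> (nat \<Rightarrow> 'a::field) set \<Rightarrow> (nat \<Rightarrow> 'a) set" where
  "Sym_closure n d S =
     {y \<in> cube n. \<forall>P. poly_vars_in n P \<and> symmetric_poly n P \<and> total_degree P \<le> d
        \<and> (\<forall>x\<in>S. mv_eval P x = 0) \<longrightarrow> mv_eval P y = 0}"

text \<open>
  The closures as sets of Hamming weights. The coefficient field is passed as a type argument,
  since it does not occur in the type of the result.
\<close>

definition Z_cl :: "'a::field itself \<Rightarrow> nat \<Rightarrow> nat \<Rightarrow> nat set \<Rightarrow> nat set" where
  "Z_cl K n d E = hamming_weight n ` Z_closure n d (layers n E :: (nat \<Rightarrow> 'a) set)"

definition Sym_cl :: "'a::field itself \<Rightarrow> nat \<Rightarrow> nat \<Rightarrow> nat set \<Rightarrow> nat set" where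
  "Sym_cl K n d E = hamming_weight n ` Sym_closure n d (layers n E :: (nat \<Rightarrow> 'a) set)"

definition ell :: "nat \<Rightarrow> nat \<Rightarrow> nat" where
  "ell p d = nat \<lceil>log (real p) (real d + 1)\<rceil>"

text \<open>
  Both closures of a union of layers are again unions of layers, so passing to Hamming weights
  loses no information.
\<close>

lemma lookup_map_key:
  "inj f \<Longrightarrow> Poly_Mapping.lookup (Poly_Mapping.map_key f p) k = Poly_Mapping.lookup p (f k)"
  by (simp add: Poly_Mapping.map_key.rep_eq)

lemma map_key_inv:
  fixes \<pi> :: "nat \<Rightarrow> nat"
  assumes "bij \<pi>"
  shows "Poly_Mapping.map_key \<pi> (Poly_Mapping.map_key (Hilbert_Choice.inv \<pi>) m) = m"
    and "Poly_Mapping.map_key (Hilbert_Choice.inv \<pi>) (Poly_Mapping.map_key \<pi> m) = m"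
  using assms
  by (auto intro!: poly_mapping_eqI
      simp: lookup_map_key bij_is_inj bij_imp_bij_inv inv_f_f surj_f_inv_f bij_is_surj)

lemma bij_map_key:
  fixes \<pi> :: "nat \<Rightarrow> nat"
  assumes "bij \<pi>"
  shows "bij (Poly_Mapping.map_key \<pi>)"
  by (rule bij_betw_byWitness[where f' = "Poly_Mapping.map_key (Hilbert_Choice.inv \<pi>)"])
     (auto simp: map_key_inv[OF assms])

lemma keys_map_key_bij:
  assumes "bij \<pi>"
  shows "Poly_Mapping.keys (Poly_Mapping.map_key \<pi> m) = \<pi> -` Poly_Mapping.keys m"
  using assms by (auto simp: in_keys_iff lookup_map_key bij_is_inj)

lemma keys_permute_vars:
  assumes "bij \<pi>"
  shows "Poly_Mapping.keys (permute_vars \<pi> P)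
       = Poly_Mapping.map_key \<pi> -` Poly_Mapping.keys P"
  using assms unfolding permute_vars_def
  by (auto simp: in_keys_iff lookup_map_key bij_is_inj bij_map_key)

lemma monom_degree_map_key:
  assumes "bij \<pi>"
  shows "monom_degree (Poly_Mapping.map_key \<pi> m) = monom_degree m"
  unfolding monom_degree_def
  by (rule sum.reindex_bij_witness[where i = "Hilbert_Choice.inv \<pi>" and j = \<pi>])
     (use assms in \<open>auto simp: keys_map_key_bij lookup_map_key bij_is_inj inv_f_f surj_f_inv_f
        bij_is_surj in_keys_iff\<close>)

lemma eval_permute_vars:
  assumes "bij \<pi>"
  shows "mv_eval (permute_vars \<pi> P) x = mv_eval P (x \<circ> \<pi>)"
proof -
  have mon: "(\<Prod>i\<in>Poly_Mapping.keys m. x i ^ Poly_Mapping.lookup m i)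
     = (\<Prod>i\<in>Poly_Mapping.keys (Poly_Mapping.map_key \<pi> m).
          (x \<circ> \<pi>) i ^ Poly_Mapping.lookup (Poly_Mapping.map_key \<pi> m) i)" for m
    by (rule prod.reindex_bij_witness[where j = "Hilbert_Choice.inv \<pi>" and i = \<pi>])
       (use assms in \<open>auto simp: keys_map_key_bij lookup_map_key bij_is_inj inv_f_f surj_f_inv_f
          bij_is_surj in_keys_iff\<close>)
  have inj: "inj (Poly_Mapping.map_key \<pi> :: (nat \<Rightarrow>\<^sub>0 nat) \<Rightarrow> _)"
    using assms by (simp add: bij_map_key bij_is_inj)
  have coeff: "Poly_Mapping.lookup (permute_vars \<pi> P) m
      = Poly_Mapping.lookup P (Poly_Mapping.map_key \<pi> m)" for m
    unfolding permute_vars_def by (rule lookup_map_key[OF inj])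
  show ?thesis
    unfolding mv_eval_def
    by (rule sum.reindex_bij_witness[where i = "Poly_Mapping.map_key (Hilbert_Choice.inv \<pi>)"
          and j = "Poly_Mapping.map_key \<pi>"])
       (simp_all only: keys_permute_vars[OF assms] map_key_inv[OF assms] mon[symmetric] coeff
          vimage_eq)
qed

lemma total_degree_permute_vars:
  assumes "bij \<pi>"
  shows "total_degree (permute_vars \<pi> P) = total_degree P"
proof -
  have "monom_degree ` Poly_Mapping.keys (permute_vars \<pi> P) = monom_degree ` Poly_Mapping.keys P"
  proof (intro equalityI subsetI)
    fix k assume "k \<in> monom_degree ` Poly_Mapping.keys P"
    then obtain m where m: "m \<in> Poly_Mapping.keys P" "k = monom_degree m" by auto
    then have "k = monom_degree (Poly_Mapping.map_key (Hilbert_Choice.inv \<pi>) m)"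
      "Poly_Mapping.map_key (Hilbert_Choice.inv \<pi>) m \<in> Poly_Mapping.keys (permute_vars \<pi> P)"
      using assms by (auto simp: monom_degree_map_key bij_imp_bij_inv keys_permute_vars map_key_inv)
    then show "k \<in> monom_degree ` Poly_Mapping.keys (permute_vars \<pi> P)" by blast
  next
    fix k assume "k \<in> monom_degree ` Poly_Mapping.keys (permute_vars \<pi> P)"
    then obtain m where "Poly_Mapping.map_key \<pi> m \<in> Poly_Mapping.keys P" "k = monom_degree m"
      using keys_permute_vars[OF assms] by auto
    then show "k \<in> monom_degree ` Poly_Mapping.keys P"
      using monom_degree_map_key[OF assms, of m] by (metis imageI)
  qed
  then show ?thesis unfolding total_degree_def by simp
qed

lemma poly_vars_in_permute_vars:
  assumes "\<pi> permutes {..<n}" "poly_vars_in n P"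
  shows "poly_vars_in n (permute_vars \<pi> P)"
proof -
  have b: "bij \<pi>" using assms(1) by (rule permutes_bij)
  show ?thesis
    unfolding poly_vars_in_def
  proof (intro ballI subsetI)
    fix m i assume m: "m \<in> Poly_Mapping.keys (permute_vars \<pi> P)" and i: "i \<in> Poly_Mapping.keys m"
    have "Poly_Mapping.map_key \<pi> m \<in> Poly_Mapping.keys P"
      using m by (simp add: keys_permute_vars[OF b])
    then have "\<pi> -` Poly_Mapping.keys m \<subseteq> {..<n}"
      using assms(2) unfolding poly_vars_in_def keys_map_key_bij[OF b, symmetric] by blast
    moreover have "Hilbert_Choice.inv \<pi> i \<in> \<pi> -` Poly_Mapping.keys m"
      using i b by (simp add: surj_f_inv_f bij_is_surj)
    ultimately have "Hilbert_Choice.inv \<pi> i \<in> {..<n}" by blast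
    then show "i \<in> {..<n}"
      using assms(1) b by (metis permutes_in_image surj_f_inv_f bij_is_surj)
  qed
qed

lemma cube_permute:
  assumes "\<pi> permutes {..<n}" "x \<in> cube n"
  shows "x \<circ> \<pi> \<in> cube n" "hamming_weight n (x \<circ> \<pi>) = hamming_weight n x"
proof -
  show "x \<circ> \<pi> \<in> cube n"
    using assms permutes_in_image[OF assms(1)] permutes_not_in[OF assms(1)]
    by (auto simp: cube_def PiE_iff extensional_def)
  have "bij_betw \<pi> {i \<in> {..<n}. (x \<circ> \<pi>) i = 1} {i \<in> {..<n}. x i = 1}"
    by (rule bij_betw_byWitness[where f' = "Hilbert_Choice.inv \<pi>"])
       (use assms permutes_in_image[OF assms(1)] permutes_in_image[OF permutes_inv[OF assms(1)]]
          permutes_inverses[OF assms(1)] in auto)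
  then show "hamming_weight n (x \<circ> \<pi>) = hamming_weight n x"
    unfolding hamming_weight_def by (rule bij_betw_same_card)
qed

lemma same_weight_permute:
  assumes y: "y \<in> cube n" and z: "z \<in> cube n" and w: "hamming_weight n y = hamming_weight n z"
  obtains \<pi> where "\<pi> permutes {..<n}" "z = y \<circ> \<pi>"
proof -
  define A B where "A = {i \<in> {..<n}. z i = 1}" and "B = {i \<in> {..<n}. y i = 1}"
  have fin: "finite A" "finite B" and sub: "A \<subseteq> {..<n}" "B \<subseteq> {..<n}" by (auto simp: A_def B_def)
  have card: "card A = card B" using w by (simp add: A_def B_def hamming_weight_def)
  obtain f where f: "bij_betw f A B" using fin card finite_same_card_bij by blast
  have "card ({..<n} - A) = card ({..<n} - B)" using fin sub card by (simp add: card_Diff_subset)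
  then obtain g where g: "bij_betw g ({..<n} - A) ({..<n} - B)"
    using finite_same_card_bij by (metis finite_Diff finite_lessThan)
  define \<pi> where "\<pi> i = (if i \<in> A then f i else if i < n then g i else i)" for i
  have "bij_betw \<pi> A B" using f by (rule bij_betw_cong[THEN iffD1, rotated]) (simp add: \<pi>_def)
  moreover have "bij_betw \<pi> ({..<n} - A) ({..<n} - B)"
    using g by (rule bij_betw_cong[THEN iffD1, rotated]) (simp add: \<pi>_def)
  ultimately have "bij_betw \<pi> (A \<union> ({..<n} - A)) (B \<union> ({..<n} - B))"
    by (rule bij_betw_combine) auto
  then have bij: "bij_betw \<pi> {..<n} {..<n}" using sub by (simp add: Un_absorb1)
  have perm: "\<pi> permutes {..<n}"
    by (rule bij_imp_permutes[OF bij]) (use sub in \<open>auto simp: \<pi>_def\<close>)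
  have "z i = y (\<pi> i)" for i
  proof -
    consider "i \<in> A" | "i \<in> {..<n} - A" | "i \<ge> n" by force
    then show ?thesis
    proof cases
      case 1
      then have "\<pi> i \<in> B" using f by (auto simp: \<pi>_def bij_betw_def)
      with 1 show ?thesis by (auto simp: A_def B_def)
    next
      case 2
      then have "\<pi> i \<in> {..<n} - B" using g by (auto simp: \<pi>_def bij_betw_def)
      moreover have "z i \<in> {0, 1}" "y (\<pi> i) \<in> {0, 1}"
        using 2 y z calculation by (auto simp: cube_def PiE_iff)
      ultimately show ?thesis using 2 by (auto simp: A_def B_def)
    next
      case 3
      with sub have "\<pi> i = i" by (auto simp: \<pi>_def)
      with 3 y z show ?thesis by (auto simp: cube_def PiE_iff extensional_def)
    qed
  qed
  then have "z = y \<circ> \<pi>" by (simp add: fun_eq_iff)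
  with perm show thesis by (rule that)
qed

lemma Z_closure_permute:
  fixes y :: "nat \<Rightarrow> 'a::field"
  assumes "\<pi> permutes {..<n}" "y \<in> Z_closure n d (layers n E)"
  shows "y \<circ> \<pi> \<in> Z_closure n d (layers n E)"
proof -
  have b: "bij \<pi>" using assms(1) by (rule permutes_bij)
  have "mv_eval P (y \<circ> \<pi>) = 0"
    if P: "poly_vars_in n P" "total_degree P \<le> d" "\<forall>x\<in>layers n E. mv_eval P x = 0" for P
  proof -
    have "\<forall>x\<in>layers n E. mv_eval (permute_vars \<pi> P) x = 0"
    proof
      fix x :: "nat \<Rightarrow> 'a" assume "x \<in> layers n E"
      then have "x \<circ> \<pi> \<in> layers n E"
        by (simp add: layers_def cube_permute[OF assms(1)])
      then show "mv_eval (permute_vars \<pi> P) x = 0"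
        using P(3) by (simp add: eval_permute_vars[OF b])
    qed
    then have "mv_eval (permute_vars \<pi> P) y = 0"
      using assms(2) P poly_vars_in_permute_vars[OF assms(1) P(1)]
      by (auto simp: Z_closure_def total_degree_permute_vars[OF b])
    then show ?thesis by (simp add: eval_permute_vars[OF b])
  qed
  then show ?thesis using assms(2) by (auto simp: Z_closure_def cube_permute[OF assms(1)])
qed

lemma Sym_closure_permute:
  assumes "\<pi> permutes {..<n}" "y \<in> Sym_closure n d S"
  shows "y \<circ> \<pi> \<in> Sym_closure n d S"
proof -
  have b: "bij \<pi>" using assms(1) by (rule permutes_bij)
  have "mv_eval P (y \<circ> \<pi>) = mv_eval P y" if "symmetric_poly n P" for P
    using that assms(1) eval_permute_vars[OF b, of P y] by (simp add: symmetric_poly_def)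
  then show ?thesis using assms(2) by (auto simp: Sym_closure_def cube_permute[OF assms(1)])
qed

lemma layers_Z_cl:
  "layers n (Z_cl TYPE('a::field) n d E) = Z_closure n d (layers n E :: (nat \<Rightarrow> 'a) set)"
proof (intro equalityI subsetI)
  fix z :: "nat \<Rightarrow> 'a" assume "z \<in> layers n (Z_cl TYPE('a) n d E)"
  then obtain y :: "nat \<Rightarrow> 'a" where z: "z \<in> cube n" and y: "y \<in> Z_closure n d (layers n E)"
    "hamming_weight n y = hamming_weight n z" by (auto simp: layers_def Z_cl_def)
  then have "y \<in> cube n" by (simp add: Z_closure_def)
  then obtain \<pi> where "\<pi> permutes {..<n}" "z = y \<circ> \<pi>"
    using z y(2) by (rule same_weight_permute)
  then show "z \<in> Z_closure n d (layers n E)" using y Z_closure_permute by blast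
qed (auto simp: layers_def Z_cl_def Z_closure_def)

lemma layers_Sym_cl:
  "layers n (Sym_cl TYPE('a::field) n d E) = Sym_closure n d (layers n E :: (nat \<Rightarrow> 'a) set)"
proof (intro equalityI subsetI)
  fix z :: "nat \<Rightarrow> 'a" assume "z \<in> layers n (Sym_cl TYPE('a) n d E)"
  then obtain y :: "nat \<Rightarrow> 'a" where z: "z \<in> cube n" and y: "y \<in> Sym_closure n d (layers n E)"
    "hamming_weight n y = hamming_weight n z" by (auto simp: layers_def Sym_cl_def)
  then have "y \<in> cube n" by (simp add: Sym_closure_def)
  then obtain \<pi> where "\<pi> permutes {..<n}" "z = y \<circ> \<pi>"
    using z y(2) by (rule same_weight_permute)
  then show "z \<in> Sym_closure n d (layers n E)" using y Sym_closure_permute by blast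
qed (auto simp: layers_def Sym_cl_def Sym_closure_def)

end

theory Submission
  imports Defs
begin

text \<open>
  Let \<open>q = p ^ ell p d > d\<close> and let \<open>P\<close> have degree at most \<open>d\<close>. For disjoint \<open>Y\<close>, \<open>N\<close>, summing the
  values of \<open>P\<close> at \<open>Y \<union> T\<close> over all \<open>t\<close>-subsets \<open>T\<close> of \<open>N\<close> gives
  \<open>\<Sum>s\<le>d. a\<^sub>s * ((|N| - s) choose (t - s))\<close>, where \<open>a\<^sub>0 = P(Y)\<close> and \<open>\<Sum>\<^sub>s a\<^sub>s = P(Y \<union> N)\<close>.
  Taking \<open>|N| = q + d\<close>, the binomials modulo \<open>p\<close> reduce this to \<open>P(Y)\<close> for \<open>t = q\<close> and to
  \<open>P(Y \<union> N)\<close> for \<open>t = d\<close>; hence vanishing on a layer in \<open>[d, n - d]\<close> propagates to all layers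
  congruent to it modulo \<open>q\<close>.
  Taking \<open>|N| = q - 1\<close>, the binomial becomes \<open>(-1)\<^sup>t (-1)\<^sup>s (t choose s)\<close>, so up to the sign \<open>(-1)\<^sup>t\<close>
  the sum is a \<open>q\<close>-periodic combination of the \<open>t choose s\<close>, \<open>s \<le> d\<close>. After a shift by \<open>|Y|\<close> it is
  the restriction to the layers of a symmetric polynomial of degree at most \<open>d\<close> which vanishes on
  \<open>E\<close> if \<open>P\<close> does, and whose value at the weight of \<open>Y\<close> is \<open>P(Y)\<close>.
\<close>

section \<open>Binomial coefficients modulo a prime\<close>

text \<open>Absorption gives
  \<open>k * (p ^ l choose k) = p ^ l * ((p ^ l - 1) choose (k - 1))\<close>. Were the binomial
  prime to \<open>p\<close>, all of \<open>p ^ l\<close> would divide the smaller positive number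
  \<open>k\<close>.\<close>

lemma prime_dvd_prime_power_choose:
  fixes p :: nat
  assumes "prime p" "0 < k" "k < p ^ l"
  shows "p dvd (p ^ l choose k)"
proof (rule ccontr)
  assume "\<not> p dvd (p ^ l choose k)"
  then have cop: "coprime (p ^ l) (p ^ l choose k)"
    using assms(1) by (simp add: prime_imp_coprime)
  have "k * (p ^ l choose k) = p ^ l * ((p ^ l - 1) choose (k - 1))"
    using times_binomial_minus1_eq[OF assms(2)] by blast
  then have "p ^ l dvd k * (p ^ l choose k)" by simp
  then have "p ^ l dvd k" using cop by (simp add: coprime_dvd_mult_left_iff)
  then show False using assms(2,3) by (simp add: dvd_imp_le leD)
qed

text \<open>\<open>K\<close> only carries the type of the field. The case \<open>l = 0\<close>,
  \<open>q = 1\<close> is included; it is the one that arises for \<open>d = 0\<close>.\<close>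

locale char_prime_power =
  fixes p l q :: nat and K :: "'a::field itself"
  assumes prime_p: "prime p"
    and of_nat_p: "of_nat p = (0::'a)"
    and q_def: "q = p ^ l"
begin

lemma q_pos: "0 < q"
  using prime_p by (simp add: q_def prime_gt_0_nat)

lemma of_nat_choose_q:
  assumes "0 < k" "k < q"
  shows "of_nat (q choose k) = (0::'a)"
proof -
  obtain c where "q choose k = p * c"
    using prime_dvd_prime_power_choose[OF prime_p assms[unfolded q_def]] q_def by auto
  then show ?thesis by (simp add: of_nat_p)
qed

text \<open>In characteristic \<open>p\<close>, (1 + X)^(q + m) = (1 + X^q) (1 + X)^m, so the
  coefficients below X^q are those of (1 + X)^m. Vandermonde's identity expresses this
  coefficientwise.\<close>

lemma of_nat_choose_add_q:
  assumes "k < q"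
  shows "of_nat ((q + m) choose k) = (of_nat (m choose k) :: 'a)"
proof -
  have "of_nat ((q + m) choose k)
      = (\<Sum>i\<le>k. of_nat (q choose i) * of_nat (m choose (k - i)) :: 'a)"
    by (simp flip: vandermonde)
  also have "\<dots> = (\<Sum>i\<in>{0}. of_nat (q choose i) * of_nat (m choose (k - i)))"
    by (rule sum.mono_neutral_right) (use assms of_nat_choose_q in auto)
  finally show ?thesis by simp
qed

lemma of_nat_choose_mod_q:
  assumes "k < q"
  shows "of_nat ((m mod q) choose k) = (of_nat (m choose k) :: 'a)"
proof -
  have "of_nat ((q * j + r) choose k) = (of_nat (r choose k) :: 'a)" for j r
    using of_nat_choose_add_q[OF assms] by (induction j) (simp_all add: add.assoc)
  from this[of "m div q" "m mod q"] show ?thesis by simp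
qed

text \<open>Neighbouring entries of row \<open>q - 1\<close> of Pascal's triangle add up to an inner
  entry of row \<open>q\<close>, which is 0, so the signs alternate.\<close>

lemma of_nat_choose_q_minus_1:
  "k < q \<Longrightarrow> of_nat ((q - 1) choose k) = ((- 1) ^ k :: 'a)"
proof (induction k)
  case (Suc k)
  have "q choose Suc k = ((q - 1) choose k) + ((q - 1) choose Suc k)"
    using q_pos by (metis Suc_diff_1 binomial_Suc_Suc)
  then have "of_nat ((q - 1) choose k) + of_nat ((q - 1) choose Suc k) = (0::'a)"
    using of_nat_choose_q[of "Suc k"] Suc.prems by (metis of_nat_add zero_less_Suc)
  then show ?case using Suc by (simp add: add_eq_0_iff)
qed simp

text \<open>Upper negation: modulo \<open>q\<close> the top argument is -1 - j, and the binomial (-1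
  - j choose k) equals (-1)^k (j + k choose k).\<close>

lemma of_nat_choose_q_minus:
  "j + k < q \<Longrightarrow> of_nat ((q - 1 - j) choose k) = ((- 1) ^ k * of_nat ((j + k) choose k) :: 'a)"
proof (induction j arbitrary: k)
  case 0
  then show ?case using of_nat_choose_q_minus_1 by simp
next
  case (Suc j)
  note IH = Suc.IH
  from Suc.prems show ?case
  proof (induction k)
    case (Suc k)
    \<comment> \<open>Pascal's rule yields the entry for (\<open>Suc j\<close>,
      \<open>Suc k\<close>) from the one for (\<open>j\<close>, \<open>Suc k\<close>), known by the
      outer induction, and the one for (\<open>Suc j\<close>, \<open>k\<close>), known by the
      inner.\<close>
    have "q - 1 - j = Suc (q - 1 - Suc j)" using Suc.prems by simp
    then have "of_nat ((q - 1 - j) choose Suc k)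
        = (of_nat ((q - 1 - Suc j) choose k) + of_nat ((q - 1 - Suc j) choose Suc k) :: 'a)"
      by (metis binomial_Suc_Suc of_nat_add)
    moreover have "of_nat ((q - 1 - j) choose Suc k)
        = ((- 1) ^ Suc k * of_nat ((j + Suc k) choose Suc k) :: 'a)"
      using Suc.prems by (intro IH) simp
    moreover have "of_nat ((q - 1 - Suc j) choose k)
        = ((- 1) ^ k * of_nat ((Suc j + k) choose k) :: 'a)"
      using Suc by simp
    ultimately show ?case by (simp add: algebra_simps)
  qed simp
qed

end

section \<open>Polynomials on the cube\<close>

text \<open>Lets points of the cube be handled as subsets of \<open>{..<n}\<close>. The restriction
  matches the extensional functions in \<open>cube\<close>.\<close>

definition cube_pt :: "nat \<Rightarrow> nat set \<Rightarrow> nat \<Rightarrow> 'a::zero_neq_one" where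
  "cube_pt n A = (\<lambda>i\<in>{..<n}. of_bool (i \<in> A))"

lemma cube_pt_in_layers:
  assumes "A \<subseteq> {..<n}"
  shows "cube_pt n A \<in> layers n E \<longleftrightarrow> card A \<in> E"
proof -
  have "{i \<in> {..<n}. cube_pt n A i = (1::'a)} = A"
    using assms by (auto simp: cube_pt_def)
  then show ?thesis by (auto simp: layers_def cube_def cube_pt_def hamming_weight_def)
qed

lemma layers_obtain_cube_pt:
  assumes "x \<in> layers n E"
  obtains A where "A \<subseteq> {..<n}" "card A \<in> E" "x = cube_pt n A"
proof
  show "{i \<in> {..<n}. x i = 1} \<subseteq> {..<n}" by auto
  show "card {i \<in> {..<n}. x i = 1} \<in> E"
    using assms by (simp add: layers_def hamming_weight_def)
  show "x = cube_pt n {i \<in> {..<n}. x i = 1}"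
    using assms by (fastforce simp: layers_def cube_def cube_pt_def PiE_iff extensional_def
        restrict_def fun_eq_iff)
qed

text \<open>Vacuously true for \<open>e > n\<close>, so moving up by \<open>q\<close> needs no upper
  bound on the layer.\<close>

definition vanishes_on_layer :: "nat \<Rightarrow> 'a::field mvpoly \<Rightarrow> nat \<Rightarrow> bool" where
  "vanishes_on_layer n P e \<longleftrightarrow> (\<forall>A\<subseteq>{..<n}. card A = e \<longrightarrow> mv_eval P (cube_pt n A) = 0)"

lemma vanishes_on_layers_iff:
  "(\<forall>x\<in>layers n E. mv_eval P x = 0) \<longleftrightarrow> (\<forall>e\<in>E. vanishes_on_layer n P e)"
  unfolding vanishes_on_layer_def
  by (metis layers_obtain_cube_pt cube_pt_in_layers)

text \<open>Exponents on the support are positive, so at a 0/1 point a monomial is 1 or 0 according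
  to whether all its variables are 1.\<close>

lemma mv_eval_cube_pt:
  fixes P :: "'a::field mvpoly"
  assumes "poly_vars_in n P"
  shows "mv_eval P (cube_pt n A)
       = (\<Sum>m\<in>Poly_Mapping.keys P. Poly_Mapping.lookup P m * of_bool (Poly_Mapping.keys m \<subseteq> A))"
  unfolding mv_eval_def
proof (rule sum.cong[OF refl], rule arg_cong[where f = "(*) _"])
  fix m assume "m \<in> Poly_Mapping.keys P"
  then have sub: "Poly_Mapping.keys m \<subseteq> {..<n}" using assms by (auto simp: poly_vars_in_def)
  show "(\<Prod>i\<in>Poly_Mapping.keys m. cube_pt n A i ^ Poly_Mapping.lookup m i)
      = (of_bool (Poly_Mapping.keys m \<subseteq> A) :: 'a)"
  proof (cases "Poly_Mapping.keys m \<subseteq> A")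
    case True
    then show ?thesis using sub by (auto intro!: prod.neutral simp: cube_pt_def)
  next
    case False
    then obtain i where "i \<in> Poly_Mapping.keys m" "i \<notin> A" by auto
    moreover from this have "cube_pt n A i ^ Poly_Mapping.lookup m i = (0::'a)"
      using subsetD[OF sub, of i] by (auto simp: cube_pt_def in_keys_iff zero_power)
    ultimately show ?thesis using False by (auto intro!: prod_zero)
  qed
qed

lemma card_keys_le_total_degree:
  assumes "m \<in> Poly_Mapping.keys P"
  shows "card (Poly_Mapping.keys m) \<le> total_degree P"
proof -
  have "card (Poly_Mapping.keys m) = (\<Sum>i\<in>Poly_Mapping.keys m. 1)" by simp
  also have "\<dots> \<le> monom_degree m"
    unfolding monom_degree_def by (rule sum_mono) (simp add: in_keys_iff Suc_leI)
  also have "\<dots> \<le> total_degree P"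
    unfolding total_degree_def using assms by (intro Max_ge) auto
  finally show ?thesis .
qed

section \<open>Summing a polynomial over the subsets of a block of variables\<close>

text \<open>Removing \<open>K\<close> matches these sets with the subsets of \<open>N - K\<close> of
  size \<open>t - card K\<close>. The case distinction is essential: for \<open>t < card K\<close>
  truncated subtraction would give the value 1.\<close>

lemma card_subsets_between:
  assumes "finite N" "K \<subseteq> N"
  shows "card {T. K \<subseteq> T \<and> T \<subseteq> N \<and> card T = t}
       = (if card K \<le> t then (card N - card K) choose (t - card K) else 0)"
proof (cases "card K \<le> t")
  case True
  have fin: "finite K" using assms finite_subset by blast
  have "bij_betw (\<lambda>T. T - K) {T. K \<subseteq> T \<and> T \<subseteq> N \<and> card T = t}
      {B. B \<subseteq> N - K \<and> card B = t - card K}"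
  proof (rule bij_betw_byWitness[where f' = "\<lambda>B. B \<union> K"])
    show "(\<lambda>B. B \<union> K) ` {B. B \<subseteq> N - K \<and> card B = t - card K}
        \<subseteq> {T. K \<subseteq> T \<and> T \<subseteq> N \<and> card T = t}"
    proof clarify
      fix B assume B: "B \<subseteq> N - K" "card B = t - card K"
      then have "finite B" "B \<inter> K = {}" using assms finite_subset by blast+
      then have "card (B \<union> K) = t" using B True fin by (simp add: card_Un_disjoint)
      then show "K \<subseteq> B \<union> K \<and> B \<union> K \<subseteq> N \<and> card (B \<union> K) = t" using B assms by blast
    qed
  qed (use assms fin in \<open>auto simp: card_Diff_subset\<close>)
  then show ?thesis
    using True assms fin by (simp add: bij_betw_same_card n_subsets card_Diff_subset)
next
  case False
  then have "{T. K \<subseteq> T \<and> T \<subseteq> N \<and> card T = t} = {}"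
    using assms(1) by (auto dest: card_mono[rotated] finite_subset)
  then show ?thesis using False by (simp only: card.empty if_False)
qed

text \<open>Double counting: a monomial with support inside \<open>Y \<union> N\<close> is 1 exactly
  for those \<open>T\<close> that contain its variables in \<open>N\<close>. The number of such
  \<open>T\<close> depends only on how many these are, at most \<open>d\<close>. The coefficients
  \<open>a\<close> are the same for all \<open>t\<close>.\<close>

lemma sum_over_subsets_mv_eval:
  fixes P :: "'a::field mvpoly"
  assumes "poly_vars_in n P" "total_degree P \<le> d" "finite N" "Y \<inter> N = {}"
  shows "\<exists>a. \<forall>t. (\<Sum>T | T \<subseteq> N \<and> card T = t. mv_eval P (cube_pt n (Y \<union> T)))
       = (\<Sum>s\<le>d. a s * (if s \<le> t then of_nat ((card N - s) choose (t - s)) else 0))"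
proof -
  define M where "M = Poly_Mapping.keys P \<inter> {m. Poly_Mapping.keys m \<subseteq> Y \<union> N}"
  define k where "k m = card (Poly_Mapping.keys m \<inter> N)" for m :: "nat \<Rightarrow>\<^sub>0 nat"
  define b where "b t s = (if s \<le> t then of_nat ((card N - s) choose (t - s)) else 0 :: 'a)" for t s
  define a where "a s = (\<Sum>m | m \<in> M \<and> k m = s. Poly_Mapping.lookup P m)" for s
  have count: "(\<Sum>T | T \<subseteq> N \<and> card T = t. of_bool (Poly_Mapping.keys m \<subseteq> Y \<union> T))
      = (of_bool (Poly_Mapping.keys m \<subseteq> Y \<union> N) * b t (k m) :: 'a)" for t and m :: "nat \<Rightarrow>\<^sub>0 nat"
  proof -
    have "{T. T \<subseteq> N \<and> card T = t} \<inter> {T. Poly_Mapping.keys m \<subseteq> Y \<union> T}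
        = (if Poly_Mapping.keys m \<subseteq> Y \<union> N
           then {T. Poly_Mapping.keys m \<inter> N \<subseteq> T \<and> T \<subseteq> N \<and> card T = t} else {})"
      using assms(4) by auto
    then show ?thesis
      using card_subsets_between[OF assms(3), of "Poly_Mapping.keys m \<inter> N" t] assms(3)
      by (simp add: sum_of_bool_eq b_def k_def)
  qed
  have km: "k m \<le> d" if "m \<in> M" for m
  proof -
    have "k m \<le> card (Poly_Mapping.keys m)" unfolding k_def by (intro card_mono) auto
    also have "\<dots> \<le> d" using card_keys_le_total_degree[of m P] that assms(2) by (auto simp: M_def)
    finally show ?thesis .
  qed
  have "(\<Sum>T | T \<subseteq> N \<and> card T = t. mv_eval P (cube_pt n (Y \<union> T))) = (\<Sum>s\<le>d. a s * b t s)" for t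
  proof -
    have "(\<Sum>T | T \<subseteq> N \<and> card T = t. mv_eval P (cube_pt n (Y \<union> T)))
        = (\<Sum>m\<in>Poly_Mapping.keys P. Poly_Mapping.lookup P m *
            (\<Sum>T | T \<subseteq> N \<and> card T = t. of_bool (Poly_Mapping.keys m \<subseteq> Y \<union> T)))"
      unfolding mv_eval_cube_pt[OF assms(1)] sum_distrib_left by (rule sum.swap)
    also have "\<dots> = (\<Sum>m\<in>M. Poly_Mapping.lookup P m * b t (k m))"
      unfolding count M_def by (intro sum.mono_neutral_cong_right) auto
    also have "\<dots> = (\<Sum>s\<le>d. \<Sum>m | m \<in> M \<and> k m = s. Poly_Mapping.lookup P m * b t (k m))"
      by (rule sum.group[symmetric]) (use km in \<open>auto simp: M_def\<close>)
    also have "\<dots> = (\<Sum>s\<le>d. a s * b t s)"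
      by (simp add: a_def sum_distrib_right)
    finally show ?thesis .
  qed
  then show ?thesis unfolding b_def by blast
qed

lemma subsets_card_0: "finite N \<Longrightarrow> {T. T \<subseteq> N \<and> card T = 0} = {{}}"
  by (auto dest: finite_subset)

lemma subsets_card_top: "finite N \<Longrightarrow> {T. T \<subseteq> N \<and> card T = card N} = {N}"
  by (auto dest: card_subset_eq)

section \<open>Symmetric polynomials with prescribed values on the layers\<close>

text \<open>\<open>Q\<close> is the combination of elementary symmetric polynomials with
  coefficients \<open>c\<close>: the one of degree s counts the s-subsets of \<open>A\<close>. Its
  coefficients depend only on squarefreeness and support size, which permutations preserve.\<close>

lemma symmetric_poly_exists:
  fixes c :: "nat \<Rightarrow> 'a::field"
  obtains Q where "poly_vars_in n Q" "symmetric_poly n Q" "total_degree Q \<le> d"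
    "\<And>A. A \<subseteq> {..<n} \<Longrightarrow> mv_eval Q (cube_pt n A) = (\<Sum>s\<le>d. c s * of_nat (card A choose s))"
proof -
  define mon where "mon B = Abs_poly_mapping (\<lambda>i. of_bool (i \<in> B) :: nat)" for B :: "nat set"
  have lookup_mon: "Poly_Mapping.lookup (mon B) i = of_bool (i \<in> B)" if "finite B" for B i
    unfolding mon_def using that by (subst lookup_Abs_poly_mapping) auto
  have keys_mon: "Poly_Mapping.keys (mon B) = B" if "finite B" for B
    using that by (auto simp: in_keys_iff lookup_mon)
  define good where "good m \<longleftrightarrow> Poly_Mapping.keys m \<subseteq> {..<n} \<and> (\<forall>i. Poly_Mapping.lookup m i \<le> 1)
    \<and> card (Poly_Mapping.keys m) \<le> d" for m :: "nat \<Rightarrow>\<^sub>0 nat"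
  define S where "S = {B. B \<subseteq> {..<n} \<and> card B \<le> d}"
  have finS: "finite S" "\<And>B. B \<in> S \<Longrightarrow> finite B"
    unfolding S_def by (auto intro: finite_subset[of _ "Pow {..<n}"] finite_subset)
  \<comment> \<open>The squarefree monomials correspond to a finite family of sets. This gives
    \<open>Q\<close> finite support and turns its evaluation into a sum over sets.\<close>
  have good_iff: "{m. good m} = mon ` S"
  proof (intro equalityI subsetI)
    fix m assume "m \<in> {m. good m}"
    then have m: "good m" by simp
    have "m = mon (Poly_Mapping.keys m)"
    proof (rule poly_mapping_eqI)
      fix i
      have "Poly_Mapping.lookup m i \<le> 1" using m by (auto simp: good_def)
      then show "Poly_Mapping.lookup m i = Poly_Mapping.lookup (mon (Poly_Mapping.keys m)) i"
        by (auto simp: lookup_mon in_keys_iff)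
    qed
    moreover have "Poly_Mapping.keys m \<in> S" using m by (simp add: good_def S_def)
    ultimately show "m \<in> mon ` S" by (rule image_eqI)
  next
    fix m assume "m \<in> mon ` S"
    then obtain B where m: "m = mon B" and B: "B \<in> S" by blast
    from B have "finite B" by (rule finS(2))
    then show "m \<in> {m. good m}"
      using B unfolding m S_def good_def by (simp add: lookup_mon keys_mon)
  qed
  define Q where "Q = Abs_poly_mapping
    (\<lambda>m. if good m then c (card (Poly_Mapping.keys m)) else 0)"
  have lookup_Q: "Poly_Mapping.lookup Q m = (if good m then c (card (Poly_Mapping.keys m)) else 0)" for m
    unfolding Q_def
    by (subst lookup_Abs_poly_mapping)
       (auto intro: finite_subset[of _ "{m. good m}"] simp: good_iff finS)
  have keys_Q: "good m" if "m \<in> Poly_Mapping.keys Q" for m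
    using that by (auto simp: in_keys_iff lookup_Q split: if_splits)
  have vars: "poly_vars_in n Q"
    using keys_Q by (auto simp: poly_vars_in_def good_def)
  have sym: "symmetric_poly n Q"
    unfolding symmetric_poly_def
  proof (intro allI impI poly_mapping_eqI)
    fix \<pi> and m :: "nat \<Rightarrow>\<^sub>0 nat" assume \<pi>: "\<pi> permutes {..<n}"
    then have b: "bij \<pi>" by (rule permutes_bij)
    let ?m = "Poly_Mapping.map_key \<pi> m"
    have "card (Poly_Mapping.keys ?m) = card (Poly_Mapping.keys m)"
      unfolding keys_map_key_bij[OF b] using b
      by (simp add: card_vimage_inj bij_is_inj bij_is_surj)
    moreover have "Poly_Mapping.keys ?m \<subseteq> {..<n} \<longleftrightarrow> Poly_Mapping.keys m \<subseteq> {..<n}"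
      unfolding keys_map_key_bij[OF b]
      using \<pi> b by (metis permutes_vimage vimage_mono surj_image_vimage_eq bij_is_surj image_mono
          permutes_image)
    moreover have "(\<forall>i. Poly_Mapping.lookup ?m i \<le> 1) \<longleftrightarrow> (\<forall>i. Poly_Mapping.lookup m i \<le> 1)"
      using b by (metis lookup_map_key bij_is_inj bij_pointE)
    ultimately show "Poly_Mapping.lookup (permute_vars \<pi> Q) m = Poly_Mapping.lookup Q m"
      by (simp add: permute_vars_def lookup_map_key bij_is_inj[OF bij_map_key[OF b]] lookup_Q good_def)
  qed
  have "monom_degree m \<le> d" if "good m" for m
  proof -
    have "monom_degree m \<le> (\<Sum>i\<in>Poly_Mapping.keys m. 1)"
      unfolding monom_degree_def using that by (intro sum_mono) (auto simp: good_def)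
    then show ?thesis using that by (simp add: good_def)
  qed
  then have deg: "total_degree Q \<le> d"
    using keys_Q by (auto simp: total_degree_def)
  have "mv_eval Q (cube_pt n A) = (\<Sum>s\<le>d. c s * of_nat (card A choose s))" if A: "A \<subseteq> {..<n}" for A
  proof -
    have finA: "finite A" using A finite_subset by blast
    have "mv_eval Q (cube_pt n A)
        = (\<Sum>m\<in>mon ` S. Poly_Mapping.lookup Q m * of_bool (Poly_Mapping.keys m \<subseteq> A))"
      unfolding mv_eval_cube_pt[OF vars]
      by (rule sum.mono_neutral_left) (use keys_Q good_iff finS in \<open>auto simp: in_keys_iff\<close>)
    also have "\<dots> = (\<Sum>B\<in>S. c (card B) * of_bool (B \<subseteq> A))"
    proof (subst sum.reindex)
      show "inj_on mon S" by (rule inj_on_inverseI[of _ Poly_Mapping.keys]) (simp add: keys_mon finS)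
      show "(\<Sum>B\<in>S. ((\<lambda>m. Poly_Mapping.lookup Q m * of_bool (Poly_Mapping.keys m \<subseteq> A)) \<circ> mon) B)
          = (\<Sum>B\<in>S. c (card B) * of_bool (B \<subseteq> A))"
      proof (rule sum.cong[OF refl])
        fix B assume B: "B \<in> S"
        then have "good (mon B)" using good_iff by blast
        then show "((\<lambda>m. Poly_Mapping.lookup Q m * of_bool (Poly_Mapping.keys m \<subseteq> A)) \<circ> mon) B
            = c (card B) * of_bool (B \<subseteq> A)"
          using B by (simp add: lookup_Q keys_mon finS)
      qed
    qed
    also have "\<dots> = (\<Sum>s\<le>d. \<Sum>B | B \<in> S \<and> card B = s. c (card B) * of_bool (B \<subseteq> A))"
      by (rule sum.group[OF finS(1), symmetric]) (auto simp: S_def)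
    also have "\<dots> = (\<Sum>s\<le>d. c s * of_nat (card A choose s))"
    proof (rule sum.cong[OF refl])
      fix s assume "s \<in> {..d}"
      then have "{B. B \<in> S \<and> card B = s} \<inter> {B. B \<subseteq> A} = {B. B \<subseteq> A \<and> card B = s}"
        using A by (auto simp: S_def)
      moreover have "(\<Sum>B | B \<in> S \<and> card B = s. c (card B) * of_bool (B \<subseteq> A))
          = c s * (\<Sum>B | B \<in> S \<and> card B = s. of_bool (B \<subseteq> A))"
        by (simp add: sum_distrib_left)
      ultimately show "(\<Sum>B | B \<in> S \<and> card B = s. c (card B) * of_bool (B \<subseteq> A))
          = c s * of_nat (card A choose s)"
        using finS(1) finA by (simp add: sum_of_bool_eq n_subsets)
    qed
    finally show ?thesis .
  qed
  with vars sym deg show thesis by (rule that)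
qed

text \<open>Turns membership in the symmetric closure into a statement about one-variable functions
  of the weight.\<close>

lemma Sym_cl_vanishing:
  fixes c :: "nat \<Rightarrow> 'a::field"
  assumes "w \<in> Sym_cl TYPE('a) n d E"
    and "\<And>e. e \<in> E \<Longrightarrow> (\<Sum>s\<le>d. c s * of_nat (e choose s)) = 0"
  shows "(\<Sum>s\<le>d. c s * of_nat (w choose s)) = 0"
proof -
  obtain Q where Q: "poly_vars_in n Q" "symmetric_poly n Q" "total_degree Q \<le> d"
    and eval: "\<And>A. A \<subseteq> {..<n} \<Longrightarrow>
      mv_eval Q (cube_pt n A) = (\<Sum>s\<le>d. c s * of_nat (card A choose s))"
    using symmetric_poly_exists[of n d c] by metis
  have "\<forall>x\<in>layers n E. mv_eval Q x = 0"
    using eval assms(2) by (auto elim!: layers_obtain_cube_pt)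
  moreover obtain y :: "nat \<Rightarrow> 'a" where y: "y \<in> Sym_closure n d (layers n E)"
    "w = hamming_weight n y"
    using assms(1) by (auto simp: Sym_cl_def)
  ultimately have "mv_eval Q y = 0" using Q by (auto simp: Sym_closure_def)
  moreover have "y \<in> layers n {w}" using y by (auto simp: Sym_closure_def layers_def)
  ultimately show ?thesis using eval by (auto elim!: layers_obtain_cube_pt)
qed

text \<open>By Vandermonde's identity the span of the functions \<open>v choose s\<close> with
  \<open>s \<le> d\<close> is closed under shifts; \<open>c\<close> does not depend on
  \<open>v\<close>.\<close>

lemma choose_sum_shift:
  fixes b :: "nat \<Rightarrow> 'a::field"
  obtains c where "\<And>v. (\<Sum>s\<le>d. b s * of_nat ((v + u) choose s)) = (\<Sum>s\<le>d. c s * of_nat (v choose s))"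
proof
  fix v
  have "(\<Sum>s\<le>d. b s * of_nat ((v + u) choose s))
      = (\<Sum>s\<le>d. \<Sum>i\<le>s. b s * of_nat (v choose i) * of_nat (u choose (s - i)))"
    by (simp add: sum_distrib_left mult.assoc flip: vandermonde)
  also have "\<dots> = (\<Sum>s\<le>d. \<Sum>i\<le>d. if i \<le> s then b s * of_nat (v choose i) * of_nat (u choose (s - i)) else 0)"
    by (intro sum.cong sum.mono_neutral_cong_left) auto
  also have "\<dots> = (\<Sum>i\<le>d. \<Sum>s\<le>d. if i \<le> s then b s * of_nat (v choose i) * of_nat (u choose (s - i)) else 0)"
    by (rule sum.swap)
  also have "\<dots> = (\<Sum>i\<le>d. (\<Sum>s\<le>d. if i \<le> s then b s * of_nat (u choose (s - i)) else 0) * of_nat (v choose i))"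
    by (auto simp: sum_distrib_right intro!: sum.cong)
  finally show "(\<Sum>s\<le>d. b s * of_nat ((v + u) choose s))
      = (\<Sum>i\<le>d. (\<Sum>s\<le>d. if i \<le> s then b s * of_nat (u choose (s - i)) else 0) * of_nat (v choose i))" .
qed

section \<open>Vanishing on layers\<close>

context char_prime_power
begin

text \<open>With \<open>t = q\<close> every summand lies on layer \<open>e + q\<close>, while the
  sum collapses to the value at \<open>Y\<close>. The bound on \<open>e\<close> leaves room for
  \<open>q + d\<close> coordinates outside \<open>Y\<close>.\<close>

lemma vanishes_on_layer_minus_q:
  fixes P :: "'a mvpoly"
  assumes P: "poly_vars_in n P" "total_degree P \<le> d" and "d < q"
    and "vanishes_on_layer n P (e + q)" "e + q + d \<le> n"
  shows "vanishes_on_layer n P e"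
  unfolding vanishes_on_layer_def
proof (intro allI impI)
  fix Y assume Y: "Y \<subseteq> {..<n}" "card Y = e"
  have finY: "finite Y" using Y finite_subset by blast
  have "q + d \<le> card ({..<n} - Y)" using Y finY assms by (simp add: card_Diff_subset)
  then obtain N where N: "N \<subseteq> {..<n} - Y" "card N = q + d" "finite N"
    by (rule obtain_subset_with_card_n)
  have disj: "Y \<inter> N = {}" using N by auto
  obtain a where a: "\<And>t. (\<Sum>T | T \<subseteq> N \<and> card T = t. mv_eval P (cube_pt n (Y \<union> T)))
       = (\<Sum>s\<le>d. a s * (if s \<le> t then of_nat ((card N - s) choose (t - s)) else 0))"
    using sum_over_subsets_mv_eval[OF P N(3) disj] by blast
  have "mv_eval P (cube_pt n Y) = a 0"
    using a[of 0] by (simp add: subsets_card_0 N sum.delta if_distrib cong: if_cong)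
  moreover have "a s * (if s \<le> q then of_nat ((card N - s) choose (q - s)) else 0)
      = (if s = 0 then a 0 else 0)" if "s \<le> d" for s
  proof -
    \<comment> \<open>In the field this is \<open>(d - s) choose d\<close>, which is 0 unless
      \<open>s = 0\<close>.\<close>
    have "(q + d - s) choose (q - s) = (q + (d - s)) choose d"
      using that assms(3) binomial_symmetric[of "q - s" "q + d - s"] by simp
    then show ?thesis
      using that assms(3) of_nat_choose_add_q[of d "d - s"] by (auto simp: N binomial_eq_0)
  qed
  moreover have "mv_eval P (cube_pt n (Y \<union> T)) = 0" if "T \<subseteq> N" "card T = q" for T
  proof -
    have "card (Y \<union> T) = e + q"
      using that Y N finY disj by (subst card_Un_disjoint) (auto dest: finite_subset)
    moreover have "Y \<union> T \<subseteq> {..<n}" using that Y N by auto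
    ultimately show ?thesis using assms(4) by (simp add: vanishes_on_layer_def)
  qed
  ultimately show "mv_eval P (cube_pt n Y) = 0"
    using a[of q] by simp
qed

text \<open>Here the block \<open>N\<close> is taken out of the target \<open>X\<close>, which is
  large enough as \<open>d \<le> e\<close>. With \<open>t = d\<close> every binomial becomes
  \<open>(d - s) choose (d - s)\<close>, so the sum is the value at \<open>X\<close>.\<close>

lemma vanishes_on_layer_plus_q:
  fixes P :: "'a mvpoly"
  assumes P: "poly_vars_in n P" "total_degree P \<le> d" and "d < q"
    and "vanishes_on_layer n P e" "d \<le> e"
  shows "vanishes_on_layer n P (e + q)"
  unfolding vanishes_on_layer_def
proof (intro allI impI)
  fix X assume X: "X \<subseteq> {..<n}" "card X = e + q"
  have finX: "finite X" using X finite_subset by blast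
  have "q + d \<le> card X" using X assms by simp
  then obtain N where N: "N \<subseteq> X" "card N = q + d" "finite N"
    by (rule obtain_subset_with_card_n)
  define Y where "Y = X - N"
  have disj: "Y \<inter> N = {}" and X_eq: "X = Y \<union> N" using N by (auto simp: Y_def)
  have cardY: "card Y = e - d" using X N by (simp add: Y_def card_Diff_subset)
  obtain a where a: "\<And>t. (\<Sum>T | T \<subseteq> N \<and> card T = t. mv_eval P (cube_pt n (Y \<union> T)))
       = (\<Sum>s\<le>d. a s * (if s \<le> t then of_nat ((card N - s) choose (t - s)) else 0))"
    using sum_over_subsets_mv_eval[OF P N(3) disj] by blast
  have "mv_eval P (cube_pt n X) = (\<Sum>s\<le>d. a s)"
    using a[of "card N", unfolded subsets_card_top[OF N(3)]] N by (simp add: X_eq)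
  moreover have "(\<Sum>s\<le>d. a s * (if s \<le> d then of_nat ((card N - s) choose (d - s)) else 0))
      = (\<Sum>s\<le>d. a s)"
  proof (rule sum.cong[OF refl])
    fix s assume "s \<in> {..d}"
    then show "a s * (if s \<le> d then of_nat ((card N - s) choose (d - s)) else 0) = a s"
      using assms(3) of_nat_choose_add_q[of "d - s" "d - s"] by (simp add: N)
  qed
  moreover have "mv_eval P (cube_pt n (Y \<union> T)) = 0" if "T \<subseteq> N" "card T = d" for T
  proof -
    have "card (Y \<union> T) = e"
      using that cardY N finX disj assms(5)
      by (subst card_Un_disjoint) (auto simp: Y_def dest: finite_subset)
    moreover have "Y \<union> T \<subseteq> {..<n}" using that X N by (auto simp: Y_def)
    ultimately show ?thesis using assms(4) by (simp add: vanishes_on_layer_def)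
  qed
  then have "(\<Sum>T | T \<subseteq> N \<and> card T = d. mv_eval P (cube_pt n (Y \<union> T))) = 0"
    by (intro sum.neutral) simp
  ultimately show "mv_eval P (cube_pt n X) = 0"
    using a[of d] by (simp only:)
qed

lemma vanishes_on_layer_congruent:
  fixes P :: "'a mvpoly"
  assumes P: "poly_vars_in n P" "total_degree P \<le> d" and d: "d < q"
    and e: "vanishes_on_layer n P e" "d \<le> e" "e + d \<le> n"
    and "f mod q = e mod q"
  shows "vanishes_on_layer n P f"
proof (cases "e \<le> f")
  case True
  then obtain k where k: "f = e + q * k"
    using assms(7) by (metis mod_eq_nat1E)
  have "vanishes_on_layer n P (e + q * k)"
  proof (induction k)
    case (Suc k)
    then show ?case
      using vanishes_on_layer_plus_q[OF P d, of "e + q * k"] e(2) by (simp add: algebra_simps)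
  qed (use e in simp)
  then show ?thesis using k by simp
next
  case False
  then obtain k where k: "e = f + q * k"
    using assms(7) by (metis mod_eq_nat1E nat_le_linear)
  have "vanishes_on_layer n P (f + q * k) \<Longrightarrow> f + q * k + d \<le> n \<Longrightarrow> vanishes_on_layer n P f"
  proof (induction k)
    case (Suc k)
    then show ?case
      using vanishes_on_layer_minus_q[OF P d, of "f + q * k"] by (simp add: algebra_simps)
  qed simp
  then show ?thesis using k e by simp
qed

text \<open>The bound on \<open>w'\<close> leaves \<open>q - 1\<close> coordinates outside
  \<open>Y\<close>, enough for the layers \<open>w'\<close> to \<open>w' + q - 1\<close> to meet
  every residue class modulo \<open>q\<close>.\<close>

lemma Sym_cl_imp_vanishes_on_layer:
  fixes P :: "'a mvpoly"
  assumes P: "poly_vars_in n P" "total_degree P \<le> d" and d: "d < q"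
    and E: "E \<subseteq> {d..n - d}" "d \<le> n" "\<And>e. e \<in> E \<Longrightarrow> vanishes_on_layer n P e"
    and w: "w \<in> Sym_cl TYPE('a) n d E" "w' mod q = w mod q" "w' + q \<le> Suc n"
  shows "vanishes_on_layer n P w'"
  unfolding vanishes_on_layer_def
proof (intro allI impI)
  fix Y assume Y: "Y \<subseteq> {..<n}" "card Y = w'"
  have finY: "finite Y" using Y finite_subset by blast
  have "q - 1 \<le> card ({..<n} - Y)" using Y finY w by (simp add: card_Diff_subset)
  then obtain N where N: "N \<subseteq> {..<n} - Y" "card N = q - 1" "finite N"
    by (rule obtain_subset_with_card_n)
  have disj: "Y \<inter> N = {}" using N by auto
  define F where "F t = (\<Sum>T | T \<subseteq> N \<and> card T = t. mv_eval P (cube_pt n (Y \<union> T)))" for t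
  obtain a where a: "\<And>t. F t
       = (\<Sum>s\<le>d. a s * (if s \<le> t then of_nat ((card N - s) choose (t - s)) else 0))"
    unfolding F_def using sum_over_subsets_mv_eval[OF P N(3) disj] by blast
  \<comment> \<open>The signs come from upper negation in row \<open>q - 1 - s\<close>;
    \<open>h\<close> extends \<open>F\<close>, up to sign, from \<open>t < q\<close> to a
    \<open>q\<close>-periodic function.\<close>
  define h where "h v = (\<Sum>s\<le>d. a s * (- 1) ^ s * of_nat (v choose s))" for v
  have h_mod: "h (v mod q) = h v" for v
    unfolding h_def using d by (intro sum.cong refl arg_cong[where f = "(*) _"] of_nat_choose_mod_q) simp
  have h_F: "h t = (- 1) ^ t * F t" if "t < q" for t
    unfolding h_def a sum_distrib_left
  proof (rule sum.cong[OF refl])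
    fix s
    show "a s * (- 1) ^ s * of_nat (t choose s)
        = (- 1) ^ t * (a s * (if s \<le> t then of_nat ((card N - s) choose (t - s)) else 0))"
    proof (cases "s \<le> t")
      case True
      have "of_nat ((q - 1 - s) choose (t - s)) = ((- 1) ^ (t - s) * of_nat (t choose s) :: 'a)"
        using of_nat_choose_q_minus[of s "t - s"] True that binomial_symmetric[OF True] by simp
      moreover have "(- 1) ^ t * (- 1) ^ (t - s) = ((- 1) ^ s :: 'a)"
      proof -
        have "t + (t - s) = 2 * (t - s) + s" using True by simp
        then have "(- 1) ^ t * (- 1) ^ (t - s) = ((- 1) ^ (2 * (t - s) + s) :: 'a)"
          by (metis power_add)
        then show ?thesis by (simp add: power_add)
      qed
      ultimately show ?thesis using True by (simp add: N algebra_simps)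
    qed (simp add: binomial_eq_0)
  qed
  \<comment> \<open>A natural number congruent to -w' modulo \<open>q\<close>.\<close>
  define u where "u = q * w' - w'"
  have w'u: "w' + u = q * w'" using q_pos by (simp add: u_def)
  obtain c where c: "\<And>v. h (v + u) = (\<Sum>s\<le>d. c s * of_nat (v choose s))"
    unfolding h_def using choose_sum_shift[where b = "\<lambda>s. a s * (- 1) ^ s"] by blast
  have "(\<Sum>s\<le>d. c s * of_nat (w choose s)) = 0"
  proof (rule Sym_cl_vanishing[OF w(1)])
    fix e assume e: "e \<in> E"
    \<comment> \<open>The residue of e - w', so layer \<open>w' + t\<close> is congruent to
      \<open>e\<close> and \<open>P\<close> vanishes there.\<close>
    define t where "t = (e + u) mod q"
    have t: "t < q" using q_pos by (simp add: t_def)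
    have "(w' + t) mod q = (e + (w' + u)) mod q"
      unfolding t_def by (simp add: mod_simps algebra_simps)
    then have "(w' + t) mod q = e mod q" by (simp add: w'u)
    then have van: "vanishes_on_layer n P (w' + t)"
      using vanishes_on_layer_congruent[OF P d E(3)[OF e]] e E(1,2) by force
    have "mv_eval P (cube_pt n (Y \<union> T)) = 0" if "T \<subseteq> N" "card T = t" for T
    proof -
      have "card (Y \<union> T) = w' + t"
        using that Y N finY disj by (subst card_Un_disjoint) (auto dest: finite_subset)
      moreover have "Y \<union> T \<subseteq> {..<n}" using that Y N by auto
      ultimately show ?thesis using van by (simp add: vanishes_on_layer_def)
    qed
    then have "F t = 0" by (simp add: F_def)
    then show "(\<Sum>s\<le>d. c s * of_nat (e choose s)) = 0"
      using h_F[OF t] h_mod[of "e + u"] c[of e] by (simp add: t_def)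
  qed
  then have "h (w + u) = 0" using c by simp
  moreover have "(w + u) mod q = 0"
    using w(2) w'u by (metis mod_add_left_eq mod_mult_self1_is_0)
  ultimately have "h 0 = 0" using h_mod[of "w + u"] by simp
  then show "mv_eval P (cube_pt n Y) = 0"
    using h_F[of 0] q_pos by (simp add: F_def subsets_card_0 N)
qed

end

section \<open>The choice of \<open>q\<close> and the equality of the closures\<close>

lemma less_power_ell:
  assumes "1 < p"
  shows "d < p ^ ell p d"
proof -
  have "log (real p) (real d + 1) \<le> real (ell p d)"
    unfolding ell_def by linarith
  then have "real d + 1 \<le> real p powr real (ell p d)"
    using assms by (simp add: log_le_iff)
  also have "\<dots> = real (p ^ ell p d)" using assms by (simp add: powr_realpow)
  finally show ?thesis by linarith
qed

lemma Z_cl_subset_Sym_cl: "Z_cl TYPE('a::field) n d E \<subseteq> Sym_cl TYPE('a) n d E"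
  unfolding Z_cl_def Sym_cl_def by (rule image_mono) (auto simp: Z_closure_def Sym_closure_def)

theorem theorem1p6:
  fixes p d n :: nat and E :: "nat set"
  assumes "p = CARD('p::prime_card)"
    and "n \<ge> 4 * p ^ ell p d - 1"
    and "E \<subseteq> {d..n - d}"
  shows "Z_cl TYPE('p mod_ring) n d E = Sym_cl TYPE('p mod_ring) n d E"
proof (rule equalityI[OF Z_cl_subset_Sym_cl subsetI])
  fix w assume w: "w \<in> Sym_cl TYPE('p mod_ring) n d E"
  define q where "q = p ^ ell p d"
  have prime: "prime p" using assms(1) prime_card by simp
  interpret char_prime_power p "ell p d" q "TYPE('p mod_ring)"
    by unfold_locales (use prime assms(1) q_def in simp_all)
  have d: "d < q" unfolding q_def using prime by (intro less_power_ell) (rule prime_gt_1_nat)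
  have n: "4 * q \<le> n + 1" using assms(2) by (simp add: q_def)
  obtain y :: "nat \<Rightarrow> 'p mod_ring" where y: "y \<in> Sym_closure n d (layers n E)"
    "w = hamming_weight n y"
    using w by (auto simp: Sym_cl_def)
  then have yw: "y \<in> layers n {w}" by (auto simp: Sym_closure_def layers_def)
  have "mv_eval P y = 0"
    if P: "poly_vars_in n P" "total_degree P \<le> d" "\<forall>x\<in>layers n E. mv_eval P x = 0" for P
  proof -
    have E: "\<And>e. e \<in> E \<Longrightarrow> vanishes_on_layer n P e"
      using P(3) vanishes_on_layers_iff by blast
    have small: "vanishes_on_layer n P w'" if "w' mod q = w mod q" "w' + q \<le> Suc n" for w'
      using Sym_cl_imp_vanishes_on_layer[OF P(1,2) d assms(3) _ E w that] n d by simp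
    have "vanishes_on_layer n P w"
    \<comment> \<open>A weight too close to \<open>n\<close> is reached from \<open>w - q\<close>,
      for which the room suffices since \<open>w \<le> n\<close>. Moving back up needs
      \<open>d \<le> w - q\<close>, and \<open>4 * q \<le> n + 1\<close> makes \<open>w\<close>
      exceed \<open>3 * q\<close>.\<close>
    proof (cases "w + q \<le> Suc n")
      case True
      then show ?thesis using small by simp
    next
      case False
      have "w \<le> n"
        using y(2) card_mono[of "{..<n}" "{i \<in> {..<n}. y i = 1}"] by (auto simp: hamming_weight_def)
      then have "vanishes_on_layer n P (w - q)"
        using small[of "w - q"] False n by (simp add: le_mod_geq)
      then show ?thesis
        using vanishes_on_layer_plus_q[OF P(1,2) d, of "w - q"] False n d by simp
    qed
    then show ?thesis using yw vanishes_on_layers_iff[of n "{w}" P] by blast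
  qed
  then have "y \<in> Z_closure n d (layers n E)"
    using y by (auto simp: Z_closure_def Sym_closure_def)
  then show "w \<in> Z_cl TYPE('p mod_ring) n d E" using y by (auto simp: Z_cl_def)
qed

end
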